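(* Let $G$ be a group satisfying the property $\mathsf{FM}$ and let $\nu$ be a conjugation-invariant pseudo-norm on $G$. Then: (1) For any element $g\in G$ with $s\nu(g)>0$, there exists a function $\phi\colon G\to\mathbb{R}$ which is a homogeneous $H$-quasimorphism for every $H\in\mathsf{FM}(G)$ and satisfies $\phi(g)>0$. (2) For any element $g$ of the commutator subgroup $[G,G]$ and any $H\in\mathsf{FM}(G)$, \[ s\nu(g)\leq 8\sup_\phi\frac{\phi(g)\cdot E_{H,\nu}(H)}{D(\phi)}, \] where the supremum is taken over the set of homogeneous $H$-quasimorphisms $\phi\colon G\to\mathbb{R}$.
   Context: A conjugation-invariant pseudo-norm on a group $G$ is a function $\nu\colon G\to\mathbb{R}_{\ge0}$ with $\nu(1)=0$, $\nu(f)=\nu(f^{-1})$, $\nu(fg)\le\nu(f)+\nu(g)$ and $\nu(gfg^{-1})=\nu(f)$ for all $f,g\in G$. Its stabilization is $s\nu(g)=\lim_{n\to\infty}\nu(g^n)/n$. For a subgroup $H\le G$, the fragmentation norm $\nu_H(f)$ is the minimal $k$ such that $f=g_1h_1g_1^{-1}\cdots g_kh_kg_k^{-1}$ with $g_i\in G$, $h_i\in H$ ($\nu_H(f)=\infty$ if no such decomposition exists). $G$ is c-generated by $H$ if $\nu_H(g)<\infty$ for all $g\in G$. A function $\phi\colon G\to\mathbb{R}$ is an $H$-quasimorphism if there is $C>0$ with $|\phi(fg)-\phi(f)-\phi(g)|<C\min\{\nu_H(f),\nu_H(g)\}$ for all $f,g\in G$; the infimum of such $C$ is the defect $D(\phi)$.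 It is homogeneous if $\phi(f^n)=n\phi(f)$ for all $f\in G$, $n\in\mathbb{Z}$. For a subset $K\subset G$ and $a,b\in G$, $aKb=\{akb:k\in K\}$. Define $\mathrm{D}^f_H(K)$ as the set of $h_0\in G$ such that for all $g_1,\dots,g_k\in G$ there is $h\in G$ such that every element of $hh_0h^{-1}K(hh_0h^{-1})^{-1}$ commutes with every element of $g_1Hg_1^{-1}\cup\dots\cup g_kHg_k^{-1}$. The far away displacement energy is $E_{H,\nu}(K)=\inf_{h_0\in\mathrm{D}^f_H(K)}\nu(h_0)$. $(G,H)$ satisfies property $\mathsf{FM}$ if $G$ is c-generated by $H$ and $\mathrm{D}^f_H(h_1Hh_1^{-1}\cup\dots\cup h_kHh_k^{-1})\ne\emptyset$ for all $h_1,\dots,h_k\in G$. $G$ satisfies $\mathsf{FM}$ if $(G,H)$ does for some subgroup $H$; $\mathsf{FM}(G)$ is the set of all such subgroups $H$.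
   Formalization: The quasimorphism inequality is taken with ≤ instead of <, since ν_H(1)=0 would make the strict inequality unsatisfiable at f=1; in the supremum, terms with D(φ)=0 (homomorphisms, where φ(g)=0) count as 0. *)

theory Defs
  imports "HOL-Algebra.Algebra" "HOL-Library.Extended_Real" "HOL-Library.Extended_Nat"
begin

definition conj_inv_pseudo_norm :: "('a, 'b) monoid_scheme \<Rightarrow> ('a \<Rightarrow> real) \<Rightarrow> bool" where
  "conj_inv_pseudo_norm G \<nu> \<longleftrightarrow>
     (\<forall>f\<in>carrier G. \<nu> f \<ge> 0) \<and> \<nu> \<one>\<^bsub>G\<^esub> = 0 \<and>
     (\<forall>f\<in>carrier G. \<nu> (inv\<^bsub>G\<^esub> f) = \<nu> f) \<and>
     (\<forall>f\<in>carrier G. \<forall>g\<in>carrier G. \<nu> (f \<otimes>\<^bsub>G\<^esub> g) \<le> \<nu> f + \<nu> g) \<and>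
     (\<forall>f\<in>carrier G. \<forall>g\<in>carrier G. \<nu> (g \<otimes>\<^bsub>G\<^esub> f \<otimes>\<^bsub>G\<^esub> inv\<^bsub>G\<^esub> g) = \<nu> f)"

definition stab :: "('a, 'b) monoid_scheme \<Rightarrow> ('a \<Rightarrow> real) \<Rightarrow> 'a \<Rightarrow> real" where
  "stab G \<nu> g = lim (\<lambda>n::nat. \<nu> (g [^]\<^bsub>G\<^esub> n) / real n)"

definition conjugates :: "('a, 'b) monoid_scheme \<Rightarrow> 'a set \<Rightarrow> 'a set" where
  "conjugates G H = {g \<otimes>\<^bsub>G\<^esub> h \<otimes>\<^bsub>G\<^esub> inv\<^bsub>G\<^esub> g | g h. g \<in> carrier G \<and> h \<in> H}"

definition frag_decomp :: "('a, 'b) monoid_scheme \<Rightarrow> 'a set \<Rightarrow> nat \<Rightarrow> 'a \<Rightarrow> bool" where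
  "frag_decomp G H k f \<longleftrightarrow>
     (\<exists>xs. length xs = k \<and> set xs \<subseteq> conjugates G H \<and> f = foldr (\<otimes>\<^bsub>G\<^esub>) xs \<one>\<^bsub>G\<^esub>)"

definition frag_norm :: "('a, 'b) monoid_scheme \<Rightarrow> 'a set \<Rightarrow> 'a \<Rightarrow> enat" where
  "frag_norm G H f = (if \<exists>k. frag_decomp G H k f then enat (LEAST k. frag_decomp G H k f) else \<infinity>)"

definition c_generated :: "('a, 'b) monoid_scheme \<Rightarrow> 'a set \<Rightarrow> bool" where
  "c_generated G H \<longleftrightarrow> (\<forall>g\<in>carrier G. frag_norm G H g \<noteq> \<infinity>)"

definition qm_bound :: "('a, 'b) monoid_scheme \<Rightarrow> 'a set \<Rightarrow> ('a \<Rightarrow> real) \<Rightarrow> real \<Rightarrow> bool" where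
  "qm_bound G H \<phi> C \<longleftrightarrow>
     (\<forall>f\<in>carrier G. \<forall>g\<in>carrier G.
        ereal \<bar>\<phi> (f \<otimes>\<^bsub>G\<^esub> g) - \<phi> f - \<phi> g\<bar>
          \<le> ereal C * ereal_of_enat (min (frag_norm G H f) (frag_norm G H g)))"

definition H_quasimorphism :: "('a, 'b) monoid_scheme \<Rightarrow> 'a set \<Rightarrow> ('a \<Rightarrow> real) \<Rightarrow> bool" where
  "H_quasimorphism G H \<phi> \<longleftrightarrow> (\<exists>C>0. qm_bound G H \<phi> C)"

definition qm_defect :: "('a, 'b) monoid_scheme \<Rightarrow> 'a set \<Rightarrow> ('a \<Rightarrow> real) \<Rightarrow> real" where
  "qm_defect G H \<phi> = Inf {C. C > 0 \<and> qm_bound G H \<phi> C}"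

definition homogeneous :: "('a, 'b) monoid_scheme \<Rightarrow> ('a \<Rightarrow> real) \<Rightarrow> bool" where
  "homogeneous G \<phi> \<longleftrightarrow> (\<forall>f\<in>carrier G. \<forall>n::int. \<phi> (f [^]\<^bsub>G\<^esub> n) = real_of_int n * \<phi> f)"

definition hom_H_quasimorphism :: "('a, 'b) monoid_scheme \<Rightarrow> 'a set \<Rightarrow> ('a \<Rightarrow> real) \<Rightarrow> bool" where
  "hom_H_quasimorphism G H \<phi> \<longleftrightarrow> H_quasimorphism G H \<phi> \<and> homogeneous G \<phi>"

definition far_displacers :: "('a, 'b) monoid_scheme \<Rightarrow> 'a set \<Rightarrow> 'a set \<Rightarrow> 'a set" where
  "far_displacers G H K =
     {h0 \<in> carrier G. \<forall>gs. set gs \<subseteq> carrier G \<longrightarrow>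
        (\<exists>h\<in>carrier G.
          let c = h \<otimes>\<^bsub>G\<^esub> h0 \<otimes>\<^bsub>G\<^esub> inv\<^bsub>G\<^esub> h in
          \<forall>k\<in>K. \<forall>x\<in>(\<Union>g\<in>set gs. (\<lambda>y. g \<otimes>\<^bsub>G\<^esub> y \<otimes>\<^bsub>G\<^esub> inv\<^bsub>G\<^esub> g) ` H).
            (c \<otimes>\<^bsub>G\<^esub> k \<otimes>\<^bsub>G\<^esub> inv\<^bsub>G\<^esub> c) \<otimes>\<^bsub>G\<^esub> x
              = x \<otimes>\<^bsub>G\<^esub> (c \<otimes>\<^bsub>G\<^esub> k \<otimes>\<^bsub>G\<^esub> inv\<^bsub>G\<^esub> c))}"

definition fa_energy :: "('a, 'b) monoid_scheme \<Rightarrow> 'a set \<Rightarrow> ('a \<Rightarrow> real) \<Rightarrow> 'a set \<Rightarrow> real" where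
  "fa_energy G H \<nu> K = Inf (\<nu> ` far_displacers G H K)"

definition FM_pair :: "('a, 'b) monoid_scheme \<Rightarrow> 'a set \<Rightarrow> bool" where
  "FM_pair G H \<longleftrightarrow> subgroup H G \<and> c_generated G H \<and>
     (\<forall>hs. set hs \<subseteq> carrier G \<longrightarrow>
        far_displacers G H (\<Union>h\<in>set hs. (\<lambda>y. h \<otimes>\<^bsub>G\<^esub> y \<otimes>\<^bsub>G\<^esub> inv\<^bsub>G\<^esub> h) ` H) \<noteq> {})"

definition FM_set :: "('a, 'b) monoid_scheme \<Rightarrow> 'a set set" where
  "FM_set G = {H. FM_pair G H}"

definition has_FM :: "('a, 'b) monoid_scheme \<Rightarrow> bool" where
  "has_FM G \<longleftrightarrow> FM_set G \<noteq> {}"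

end

theory Submission
  imports Defs
begin

text \<open>
  Property FM lets every element be conjugated so as to commute with any finite set of elements, so
  \<open>x \<otimes> c y c\<^sup>-\<^sup>1\<close> (with \<open>c\<close> moving \<open>y\<close> far from \<open>x\<close>) acts as a commutative addition on \<open>G\<close>. Its
  powers change by a bounded \<open>\<nu>\<close>-distance when \<open>c\<close> changes, hence it is well defined for the
  stabilization of \<open>\<nu>\<close>, which is sublinear for it. The proof of Hahn-Banach by minimal sublinear
  functionals then works inside \<open>G\<close> and yields a \<open>\<phi>\<close> that is additive for far products, with
  \<open>\<phi> \<le> s\<nu>\<close> and \<open>\<phi>(g) = s\<nu>(g)\<close>. For \<open>f \<in> H\<close> and a far displacer \<open>h\<^sub>0\<close> of \<open>H\<close>, replacing \<open>f\<close> by a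
  conjugate by a conjugate of \<open>h\<^sub>0\<close> makes it commute with \<open>g\<close> and changes \<open>\<phi>(fg)\<close> by at most
  \<open>2\<nu>(h\<^sub>0)\<close>. Splitting an element into \<open>k\<close> conjugates of elements of \<open>H\<close> uses this bound \<open>2k - 1\<close>
  times, so the defect of \<open>\<phi>\<close> is at most \<open>4E\<close>.
\<close>

section \<open>Subadditive sequences\<close>

text \<open>Fekete's argument: the quotients converge to their infimum. Division of \<open>n\<close>
  by a fixed \<open>m\<close> with nearly minimal quotient leaves a remainder whose contribution is
  bounded independently of \<open>n\<close>.\<close>

lemma subadditive_convergent:
  fixes a :: "nat \<Rightarrow> real"
  assumes sub: "\<And>m n. a (m + n) \<le> a m + a n" and nonneg: "\<And>n. 0 \<le> a n" and zero: "a 0 = 0"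
  shows "convergent (\<lambda>n. a n / real n)"
proof -
  \<comment> \<open>The index 0 is left out because \<open>a 0 / real 0\<close> is 0 by convention
    and would force the infimum to be 0.\<close>
  define L where "L = (INF n\<in>{1..}. a n / real n)"
  have bdd: "bdd_below ((\<lambda>n. a n / real n) ` {1..})"
    by (rule bdd_belowI[of _ 0]) (auto simp: nonneg)
  have mult: "a (m * q) \<le> real q * a m" for m q
  proof (induction q)
    case (Suc q)
    then show ?case using sub[of m "m * q"] by (simp add: algebra_simps)
  qed (simp add: zero)
  have "(\<lambda>n. a n / real n) \<longlonglongrightarrow> L"
  proof (rule LIMSEQ_I)
    fix e :: real assume "e > 0"
    then have "\<exists>x\<in>(\<lambda>n. a n / real n) ` {1..}. x < L + e / 2"
      unfolding L_def by (subst cInf_less_iff[symmetric]) (use bdd in auto)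
    then obtain m where m: "m \<ge> 1" "a m / real m < L + e / 2" by auto
    \<comment> \<open>\<open>M\<close> bounds the remainder term \<open>a (n mod m)\<close>; the
      bound on \<open>N\<close> below makes its share of the quotient less than
      \<open>e / 2\<close>.\<close>
    define M where "M = real m * a 1"
    obtain N where N: "real N > 2 * M / e" using reals_Archimedean2 by blast
    show "\<exists>N. \<forall>n\<ge>N. norm (a n / real n - L) < e"
    proof (intro exI[of _ "max 1 N"] allI impI)
      fix n assume n: "n \<ge> max 1 N"
      then have npos: "real n > 0" by simp
      have "L \<le> a n / real n" unfolding L_def by (rule cINF_lower[OF bdd]) (use n in auto)
      moreover have "a n / real n < L + e"
      proof -
        have "a n \<le> a (m * (n div m)) + a (n mod m)" using sub[of "m * (n div m)" "n mod m"] by simp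
        also have "a (m * (n div m)) \<le> real (n div m) * a m" by (rule mult)
        also have "a (n mod m) \<le> real (n mod m) * a 1" using mult[of 1 "n mod m"] by simp
        also have "\<dots> \<le> M" unfolding M_def using m nonneg[of 1]
          by (intro mult_right_mono) (simp_all add: less_imp_le)
        also have "real (n div m) * a m \<le> real n * (a m / real m)"
        proof -
          have "real (n div m) \<le> real n / real m" by (rule of_nat_div_le_of_nat)
          from mult_right_mono[OF this nonneg[of m]] show ?thesis by simp
        qed
        finally have "a n \<le> real n * (a m / real m) + M" by simp
        then have "a n / real n \<le> a m / real m + M / real n" using npos by (simp add: field_simps)
        moreover have "M / real n < e / 2"
        proof -
          have "2 * M / e < real n" using N n by simp
          then show ?thesis using \<open>e > 0\<close> npos by (simp add: field_simps)
        qed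
        ultimately show ?thesis using m(2) by linarith
      qed
      ultimately show "norm (a n / real n - L) < e" by simp
    qed
  qed
  then show ?thesis by (auto simp: convergent_def)
qed

section \<open>Conjugation and the pseudo-norm\<close>

locale FM_normed_group = group G for G (structure) +
  fixes \<nu> :: "'a \<Rightarrow> real"
  assumes norm: "conj_inv_pseudo_norm G \<nu>" and FM: "has_FM G"
begin

abbreviation conj_by :: "'a \<Rightarrow> 'a \<Rightarrow> 'a" where
  "conj_by c x \<equiv> c \<otimes> x \<otimes> inv c"

lemma cancel_inv [simp]:
  assumes "x \<in> carrier G" "z \<in> carrier G"
  shows "x \<otimes> (inv x \<otimes> z) = z" "inv x \<otimes> (x \<otimes> z) = z"
  using assms by (simp_all add: m_assoc[symmetric])

lemma conj_by_mult:
  assumes "c \<in> carrier G" "x \<in> carrier G" "y \<in> carrier G"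
  shows "conj_by c (x \<otimes> y) = conj_by c x \<otimes> conj_by c y"
  using assms by (simp add: m_assoc)

lemma conj_by_pow:
  assumes "c \<in> carrier G" "x \<in> carrier G"
  shows "conj_by c (x [^] (n::nat)) = conj_by c x [^] n"
  by (induction n) (use assms in \<open>simp_all add: conj_by_mult\<close>)

lemma commute_mult:
  assumes "x \<in> carrier G" "y \<in> carrier G" "z \<in> carrier G" "x \<otimes> z = z \<otimes> x" "y \<otimes> z = z \<otimes> y"
  shows "(x \<otimes> y) \<otimes> z = z \<otimes> (x \<otimes> y)"
  using assms by (metis m_assoc)

lemma commute_pow:
  assumes "x \<in> carrier G" "z \<in> carrier G" "x \<otimes> z = z \<otimes> x"
  shows "x [^] (n::nat) \<otimes> z = z \<otimes> x [^] n"
  by (induction n) (use assms in \<open>simp_all add: commute_mult\<close>)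

lemma norm_nonneg: "x \<in> carrier G \<Longrightarrow> 0 \<le> \<nu> x"
  and norm_one: "\<nu> \<one> = 0"
  and norm_inv: "x \<in> carrier G \<Longrightarrow> \<nu> (inv x) = \<nu> x"
  and norm_mult: "x \<in> carrier G \<Longrightarrow> y \<in> carrier G \<Longrightarrow> \<nu> (x \<otimes> y) \<le> \<nu> x + \<nu> y"
  and norm_conj: "x \<in> carrier G \<Longrightarrow> c \<in> carrier G \<Longrightarrow> \<nu> (conj_by c x) = \<nu> x"
  using norm unfolding conj_inv_pseudo_norm_def by blast+

lemma norm_triangle:
  assumes "x \<in> carrier G" "y \<in> carrier G" "z \<in> carrier G"
  shows "\<nu> (x \<otimes> inv z) \<le> \<nu> (x \<otimes> inv y) + \<nu> (y \<otimes> inv z)"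
  using norm_mult[of "x \<otimes> inv y" "y \<otimes> inv z"] assms by (simp add: m_assoc)

lemma norm_sym:
  assumes "x \<in> carrier G" "y \<in> carrier G"
  shows "\<nu> (x \<otimes> inv y) = \<nu> (y \<otimes> inv x)"
  using norm_inv[of "x \<otimes> inv y"] assms by (simp add: inv_mult_group)

lemma norm_diff:
  assumes "x \<in> carrier G" "y \<in> carrier G"
  shows "\<nu> x \<le> \<nu> y + \<nu> (x \<otimes> inv y)"
  using norm_mult[of "x \<otimes> inv y" y] assms by (simp add: m_assoc)

text \<open>A commutator of \<open>c\<close> and \<open>x\<close> is \<open>c\<close> times a
  conjugate of its inverse. The bound does not depend on \<open>x\<close>, so it holds uniformly for
  all powers of an element.\<close>

lemma norm_commutator:
  assumes "c \<in> carrier G" "x \<in> carrier G"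
  shows "\<nu> (conj_by c x \<otimes> inv x) \<le> 2 * \<nu> c"
proof -
  have "conj_by c x \<otimes> inv x = c \<otimes> conj_by x (inv c)" using assms by (simp add: m_assoc)
  then show ?thesis using norm_mult[of c "conj_by x (inv c)"] norm_conj[of "inv c" x] norm_inv[of c] assms
    by simp
qed

text \<open>Passing from \<open>k\<close> to \<open>Suc k\<close> inserts one conjugate of
  \<open>x \<otimes> inv y\<close> in front of the previous quotient.\<close>

lemma norm_pow_dist:
  assumes "x \<in> carrier G" "y \<in> carrier G"
  shows "\<nu> (x [^] (k::nat) \<otimes> inv (y [^] k)) \<le> real k * \<nu> (x \<otimes> inv y)"
proof (induction k)
  case (Suc k)
  have "x [^] Suc k \<otimes> inv (y [^] Suc k) = conj_by (x [^] k) (x \<otimes> inv y) \<otimes> (x [^] k \<otimes> inv (y [^] k))"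
    using assms by (simp add: m_assoc inv_mult_group)
  then have "\<nu> (x [^] Suc k \<otimes> inv (y [^] Suc k)) \<le> \<nu> (x \<otimes> inv y) + \<nu> (x [^] k \<otimes> inv (y [^] k))"
    using norm_mult[of "conj_by (x [^] k) (x \<otimes> inv y)" "x [^] k \<otimes> inv (y [^] k)"] norm_conj assms
    by simp
  then show ?case using Suc by (simp add: algebra_simps)
qed (simp add: norm_one)

section \<open>The stabilization as an admissible functional\<close>

lemma stab_LIMSEQ:
  assumes "x \<in> carrier G"
  shows "(\<lambda>n. \<nu> (x [^] n) / real n) \<longlonglongrightarrow> stab G \<nu> x"
proof -
  have "convergent (\<lambda>n. \<nu> (x [^] n) / real n)"
    by (rule subadditive_convergent) (use assms in \<open>simp_all add: norm_mult norm_nonneg norm_one flip: nat_pow_mult\<close>)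
  then show ?thesis by (simp add: stab_def convergent_LIMSEQ_iff)
qed

text \<open>
  The last clause (\<open>\<bar>q x - q y\<bar>\<close> is at most the growth rate of the distance of \<open>x\<^sup>k\<close> and \<open>y\<^sup>k\<close>) makes
  \<open>q\<close> insensitive to the choice of the displacing conjugator.
\<close>
definition admissible :: "('a \<Rightarrow> real) \<Rightarrow> bool" where
  "admissible q \<longleftrightarrow>
     (\<forall>x. x \<notin> carrier G \<longrightarrow> q x = 0) \<and>
     (\<forall>x\<in>carrier G. q x \<le> stab G \<nu> x) \<and>
     (\<forall>x\<in>carrier G. \<forall>y\<in>carrier G. x \<otimes> y = y \<otimes> x \<longrightarrow> q (x \<otimes> y) \<le> q x + q y) \<and>
     (\<forall>x\<in>carrier G. \<forall>n::nat. q (x [^] n) = real n * q x) \<and>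
     (\<forall>x\<in>carrier G. \<forall>y\<in>carrier G. \<forall>B C.
        (\<forall>k::nat. \<nu> (x [^] k \<otimes> inv (y [^] k)) \<le> B * real k + C) \<longrightarrow> q x \<le> q y + B)"

lemma admissibleD:
  assumes "admissible q"
  shows "x \<notin> carrier G \<Longrightarrow> q x = 0"
    and "x \<in> carrier G \<Longrightarrow> q x \<le> stab G \<nu> x"
    and "\<lbrakk>x \<in> carrier G; y \<in> carrier G; x \<otimes> y = y \<otimes> x\<rbrakk> \<Longrightarrow> q (x \<otimes> y) \<le> q x + q y"
    and "x \<in> carrier G \<Longrightarrow> q (x [^] (n::nat)) = real n * q x"
    and "\<lbrakk>x \<in> carrier G; y \<in> carrier G;
          \<And>k::nat. \<nu> (x [^] k \<otimes> inv (y [^] k)) \<le> B * real k + C\<rbrakk> \<Longrightarrow> q x \<le> q y + B"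
  using assms unfolding admissible_def by (blast)+

text \<open>Powers distribute over commuting products, so every clause follows by dividing an
  inequality or identity for powers by the exponent and passing to the limit.\<close>

lemma admissible_stab: "admissible (\<lambda>x. if x \<in> carrier G then stab G \<nu> x else 0)"
proof -
  have sub: "stab G \<nu> (x \<otimes> y) \<le> stab G \<nu> x + stab G \<nu> y"
    if "x \<in> carrier G" "y \<in> carrier G" "x \<otimes> y = y \<otimes> x" for x y
  proof (rule LIMSEQ_le)
    show "(\<lambda>n. \<nu> ((x \<otimes> y) [^] n) / real n) \<longlonglongrightarrow> stab G \<nu> (x \<otimes> y)"
      using that by (intro stab_LIMSEQ) simp
    show "(\<lambda>n. \<nu> (x [^] n) / real n + \<nu> (y [^] n) / real n) \<longlonglongrightarrow> stab G \<nu> x + stab G \<nu> y"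
      using that by (intro tendsto_add stab_LIMSEQ) simp_all
    show "\<exists>N. \<forall>n\<ge>N. \<nu> ((x \<otimes> y) [^] n) / real n \<le> \<nu> (x [^] n) / real n + \<nu> (y [^] n) / real n"
      using that(1,2) norm_mult
      by (auto simp: pow_mult_distrib[OF that(3,1,2)] simp flip: add_divide_distrib
          intro!: divide_right_mono exI[of _ 0])
  qed
  have hom: "stab G \<nu> (x [^] n) = real n * stab G \<nu> x" if "x \<in> carrier G" for x and n :: nat
  proof (cases "n = 0")
    case True
    then show ?thesis using LIMSEQ_unique[OF stab_LIMSEQ[of \<one>], of 0] by (simp add: norm_one)
  next
    case False
    \<comment> \<open>Homogeneity comes from the subsequence of exponents divisible by
      \<open>n\<close>; at \<open>k = 0\<close> the quotients compared below are both 0 by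
      convention.\<close>
    have "(\<lambda>k. \<nu> (x [^] (n * k)) / real (n * k)) \<longlonglongrightarrow> stab G \<nu> x"
      using LIMSEQ_subseq_LIMSEQ[OF stab_LIMSEQ[OF that], of "\<lambda>k. n * k"] False
      by (simp add: strict_mono_def o_def)
    then have "(\<lambda>k. real n * (\<nu> (x [^] (n * k)) / real (n * k))) \<longlonglongrightarrow> real n * stab G \<nu> x"
      by (intro tendsto_intros)
    moreover have "(\<lambda>k. real n * (\<nu> (x [^] (n * k)) / real (n * k))) = (\<lambda>k. \<nu> ((x [^] n) [^] k) / real k)"
      using False that by (auto simp: nat_pow_pow)
    ultimately show ?thesis using stab_LIMSEQ[of "x [^] n"] that by (auto intro: LIMSEQ_unique)
  qed
  have close: "stab G \<nu> x \<le> stab G \<nu> y + B"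
    if "x \<in> carrier G" "y \<in> carrier G" and le: "\<forall>k::nat. \<nu> (x [^] k \<otimes> inv (y [^] k)) \<le> B * real k + C"
    for x y B C
  proof (rule LIMSEQ_le)
    show "(\<lambda>n. \<nu> (x [^] n) / real n) \<longlonglongrightarrow> stab G \<nu> x" using that by (intro stab_LIMSEQ)
    have "(\<lambda>n. \<nu> (y [^] n) / real n + (B + C / real n)) \<longlonglongrightarrow> stab G \<nu> y + (B + 0)"
      using that by (intro tendsto_add stab_LIMSEQ tendsto_const lim_const_over_n)
    then show "(\<lambda>n. \<nu> (y [^] n) / real n + (B + C / real n)) \<longlonglongrightarrow> stab G \<nu> y + B" by simp
    have "\<nu> (x [^] n) / real n \<le> \<nu> (y [^] n) / real n + (B + C / real n)" if "n \<ge> 1" for n :: nat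
    proof -
      have "\<nu> (x [^] n) \<le> \<nu> (y [^] n) + (B * real n + C)"
        using norm_diff[of "x [^] n" "y [^] n"] le[rule_format, of n] \<open>x \<in> _\<close> \<open>y \<in> _\<close> by simp
      then show ?thesis using \<open>n \<ge> 1\<close> by (simp add: field_simps)
    qed
    then show "\<exists>N. \<forall>n\<ge>N. \<nu> (x [^] n) / real n \<le> \<nu> (y [^] n) / real n + (B + C / real n)" by blast
  qed
  show ?thesis unfolding admissible_def using sub hom close by auto
qed

section \<open>Fragmentation and displacement\<close>

lemma commute_foldr:
  assumes "set ys \<subseteq> carrier G" "z \<in> carrier G" "\<And>y. y \<in> set ys \<Longrightarrow> y \<otimes> z = z \<otimes> y"
  shows "foldr (\<otimes>) ys \<one> \<in> carrier G \<and> foldr (\<otimes>) ys \<one> \<otimes> z = z \<otimes> foldr (\<otimes>) ys \<one>"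
  using assms by (induction ys) (auto simp: commute_mult)

lemma conj_by_foldr:
  assumes "set ys \<subseteq> carrier G" "c \<in> carrier G"
  shows "foldr (\<otimes>) ys \<one> \<in> carrier G \<and>
    conj_by c (foldr (\<otimes>) ys \<one>) = foldr (\<otimes>) (map (conj_by c) ys) \<one>"
  using assms by (induction ys) (auto simp: conj_by_mult)

lemma c_generatedE:
  assumes "c_generated G H" "x \<in> carrier G"
  obtains ys where "set ys \<subseteq> conjugates G H" "x = foldr (\<otimes>) ys \<one>" "frag_norm G H x = enat (length ys)"
proof -
  have ex: "\<exists>k. frag_decomp G H k x"
    using assms unfolding c_generated_def frag_norm_def by (metis (full_types))
  then have "frag_decomp G H (LEAST k. frag_decomp G H k x) x" by (rule LeastI_ex)
  then obtain ys where "length ys = (LEAST k. frag_decomp G H k x)" "set ys \<subseteq> conjugates G H"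
    "x = foldr (\<otimes>) ys \<one>" by (auto simp: frag_decomp_def)
  moreover from this ex have "frag_norm G H x = enat (length ys)" by (simp add: frag_norm_def)
  ultimately show ?thesis using that by blast
qed

text \<open>Far displacers speak of finitely many conjugates of \<open>H\<close>; this finds
  finitely many conjugators that cover a given list.\<close>

lemma conjugates_list:
  assumes "set ys \<subseteq> conjugates G H"
  obtains gs where "set gs \<subseteq> carrier G" "set ys \<subseteq> (\<Union>g\<in>set gs. conj_by g ` H)"
  using assms
proof (induction ys arbitrary: thesis)
  case (Cons y ys)
  from Cons.prems(2) obtain g h where "g \<in> carrier G" "h \<in> H" "y = conj_by g h"
    by (auto simp: conjugates_def)
  moreover obtain gs where "set gs \<subseteq> carrier G" "set ys \<subseteq> (\<Union>g\<in>set gs. conj_by g ` H)"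
    using Cons.IH Cons.prems(2) by auto
  ultimately show ?case by (intro Cons.prems(1)[of "g # gs"]) auto
qed (metis empty_subsetI list.set(1))

lemma conjugates_carrier: "H \<subseteq> carrier G \<Longrightarrow> conjugates G H \<subseteq> carrier G"
  by (auto simp: conjugates_def)

text \<open>Concatenating one decomposition per element gives a single finite supply of factors;
  whatever commutes with all of \<open>zs\<close> then commutes with every element of
  \<open>xs\<close>.\<close>

lemma frag_list:
  assumes "c_generated G H" "set xs \<subseteq> carrier G"
  obtains zs where "set zs \<subseteq> conjugates G H"
    "\<And>x. x \<in> set xs \<Longrightarrow> \<exists>ys. set ys \<subseteq> set zs \<and> x = foldr (\<otimes>) ys \<one>"
  using assms(2)
proof (induction xs arbitrary: thesis)
  case Nil
  then show ?case using Nil(1)[of "[]"] by simp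
next
  case (Cons x xs)
  obtain zs where zs: "set zs \<subseteq> conjugates G H"
    "\<And>x. x \<in> set xs \<Longrightarrow> \<exists>ys. set ys \<subseteq> set zs \<and> x = foldr (\<otimes>) ys \<one>"
    using Cons.IH Cons.prems(2) by auto
  obtain ys where "set ys \<subseteq> conjugates G H" "x = foldr (\<otimes>) ys \<one>"
    using c_generatedE[OF assms(1)] Cons.prems(2) by (metis list.set_intros(1) subsetD)
  moreover have "\<exists>us. set us \<subseteq> set (ys @ zs) \<and> z = foldr (\<otimes>) us \<one>" if "z \<in> set (x # xs)" for z
  proof (cases "z = x")
    case True
    then show ?thesis using calculation by (intro exI[of _ ys]) auto
  next
    case False
    then show ?thesis using zs(2)[of z] that by auto
  qed
  ultimately show ?case using zs(1) by (intro Cons.prems(1)[of "ys @ zs"]) auto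
qed

text \<open>A suitable conjugate of \<open>h0\<close> makes \<open>K\<close> commute with the
  finitely many conjugates of \<open>H\<close> that contain the factors of \<open>xs\<close>.
  Commutation then passes to products on both sides: first to the product of \<open>ys\<close>, then
  to each element of \<open>xs\<close>.\<close>

lemma displacement:
  assumes "c_generated G H" "H \<subseteq> carrier G" "K \<subseteq> carrier G" "h0 \<in> far_displacers G H K"
    and "set ys \<subseteq> K" "set xs \<subseteq> carrier G"
  obtains h where "h \<in> carrier G"
    "\<And>x. x \<in> set xs \<Longrightarrow> x \<otimes> conj_by (conj_by h h0) (foldr (\<otimes>) ys \<one>)
                          = conj_by (conj_by h h0) (foldr (\<otimes>) ys \<one>) \<otimes> x"
proof -
  obtain zs where zs: "set zs \<subseteq> conjugates G H"
    "\<And>x. x \<in> set xs \<Longrightarrow> \<exists>ys. set ys \<subseteq> set zs \<and> x = foldr (\<otimes>) ys \<one>"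
    by (rule frag_list[OF assms(1,6)]) blast
  obtain gs where gs: "set gs \<subseteq> carrier G" "set zs \<subseteq> (\<Union>g\<in>set gs. conj_by g ` H)"
    by (rule conjugates_list[OF zs(1)]) blast
  have h0: "h0 \<in> carrier G" using assms(4) by (simp add: far_displacers_def)
  obtain h where h: "h \<in> carrier G"
    "\<forall>k\<in>K. \<forall>z\<in>(\<Union>g\<in>set gs. conj_by g ` H).
       conj_by (conj_by h h0) k \<otimes> z = z \<otimes> conj_by (conj_by h h0) k"
    using assms(4) gs(1) by (auto simp only: far_displacers_def Let_def mem_Collect_eq)
  define c where "c = conj_by h h0"
  have c: "c \<in> carrier G" using h(1) h0 by (simp add: c_def)
  have hz: "conj_by c k \<otimes> z = z \<otimes> conj_by c k" if "k \<in> K" "z \<in> set zs" for k z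
    using h(2) that gs(2) unfolding c_def by blast
  have zsG: "set zs \<subseteq> carrier G" using zs(1) conjugates_carrier assms(2) by blast
  have ysG: "set ys \<subseteq> carrier G" using assms by blast
  define w where "w = conj_by c (foldr (\<otimes>) ys \<one>)"
  have w: "w = foldr (\<otimes>) (map (conj_by c) ys) \<one>" "w \<in> carrier G"
    using conj_by_foldr[OF ysG c] c unfolding w_def by (blast, blast intro: m_closed inv_closed)
  have wz: "w \<otimes> z = z \<otimes> w" if "z \<in> set zs" for z
  proof -
    have "foldr (\<otimes>) (map (conj_by c) ys) \<one> \<otimes> z = z \<otimes> foldr (\<otimes>) (map (conj_by c) ys) \<one>"
      by (rule commute_foldr[THEN conjunct2]) (use c ysG zsG that hz assms(5) in \<open>auto simp: subset_iff\<close>)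
    then show ?thesis unfolding w(1) .
  qed
  have "x \<otimes> w = w \<otimes> x" if x: "x \<in> set xs" for x
  proof -
    obtain us where "set us \<subseteq> set zs" "x = foldr (\<otimes>) us \<one>" using zs(2) x by blast
    then show ?thesis using commute_foldr[of us w] w(2) wz zsG by (metis subset_eq)
  qed
  then show ?thesis using that h(1) unfolding w_def c_def by blast
qed

text \<open>Fragment \<open>y\<close> and let \<open>K\<close> be the union of the conjugates of
  \<open>H\<close> that contain its factors; property FM supplies a displacer of
  \<open>K\<close>.\<close>

lemma far_exists:
  assumes "set xs \<subseteq> carrier G" "y \<in> carrier G"
  obtains c where "c \<in> carrier G" "\<And>x. x \<in> set xs \<Longrightarrow> x \<otimes> conj_by c y = conj_by c y \<otimes> x"
proof -
  obtain H where H: "FM_pair G H" using FM by (auto simp: has_FM_def FM_set_def)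
  then have cg: "c_generated G H" and HG: "H \<subseteq> carrier G"
    by (auto simp: FM_pair_def subgroup.subset)
  obtain ys where ys: "set ys \<subseteq> conjugates G H" "y = foldr (\<otimes>) ys \<one>"
    by (rule c_generatedE[OF cg assms(2)]) blast
  obtain gs where gs: "set gs \<subseteq> carrier G" "set ys \<subseteq> (\<Union>g\<in>set gs. conj_by g ` H)"
    by (rule conjugates_list[OF ys(1)]) blast
  define K where "K = (\<Union>g\<in>set gs. conj_by g ` H)"
  have "K \<subseteq> carrier G" using gs HG by (force simp: K_def)
  obtain h0 where h0: "h0 \<in> far_displacers G H K"
    using H gs unfolding FM_pair_def K_def by blast
  obtain h where "h \<in> carrier G"
    "\<And>x. x \<in> set xs \<Longrightarrow> x \<otimes> conj_by (conj_by h h0) y = conj_by (conj_by h h0) y \<otimes> x"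
    by (rule displacement[OF cg HG \<open>K \<subseteq> _\<close> h0 gs(2)[folded K_def] assms(1), folded ys(2)]) blast
  moreover have "h0 \<in> carrier G" using h0 by (simp add: far_displacers_def)
  ultimately show ?thesis using that[of "conj_by h h0"] by simp
qed

section \<open>First consequences of admissibility\<close>

lemma admissible_one: "admissible q \<Longrightarrow> q \<one> = 0"
  using admissibleD(4)[of q \<one> 0] by simp

text \<open>Powers of an element and of its conjugate by \<open>c\<close> stay within
  \<open>2 * \<nu> c\<close> of each other, which is growth rate 0 in the last clause of
  admissibility.\<close>

lemma admissible_conj:
  assumes q: "admissible q" and "c \<in> carrier G" "x \<in> carrier G"
  shows "q (conj_by c x) = q x"
proof -
  have *: "\<nu> (conj_by c x [^] k \<otimes> inv (x [^] k)) \<le> 0 * real k + 2 * \<nu> c" for k :: nat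
    using norm_commutator[of c "x [^] k"] assms by (simp add: conj_by_pow)
  then have "\<nu> (x [^] k \<otimes> inv (conj_by c x [^] k)) \<le> 0 * real k + 2 * \<nu> c" for k :: nat
    using norm_sym[of "x [^] k" "conj_by c x [^] k"] assms by simp
  then have "q x \<le> q (conj_by c x) + 0" by (intro admissibleD(5)[OF q]) (use assms in simp_all)
  moreover have "q (conj_by c x) \<le> q x + 0" by (rule admissibleD(5)[OF q _ _ *]) (use assms in simp_all)
  ultimately show ?thesis by simp
qed

text \<open>The far product of \<open>x\<close> and its inverse acts as a zero element: its powers
  are commutators with \<open>c\<close>, hence bounded in norm.\<close>

lemma admissible_cancel:
  assumes q: "admissible q" and "c \<in> carrier G" "x \<in> carrier G"
    and comm: "x \<otimes> conj_by c (inv x) = conj_by c (inv x) \<otimes> x"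
  shows "q (x \<otimes> conj_by c (inv x)) = 0"
proof -
  define z where "z = x \<otimes> conj_by c (inv x)"
  have z: "z \<in> carrier G" using assms by (simp add: z_def)
  have norm_z: "\<nu> (z [^] k) \<le> 2 * \<nu> c" for k :: nat
  proof -
    have "z [^] k = x [^] k \<otimes> conj_by c (inv x) [^] k"
      unfolding z_def by (rule pow_mult_distrib[OF comm]) (use assms in simp_all)
    also have "conj_by c (inv x) [^] k = conj_by c (inv x [^] k)"
      using assms by (intro conj_by_pow[symmetric]) simp_all
    also have "x [^] k \<otimes> \<dots> = inv (conj_by c (x [^] k) \<otimes> inv (x [^] k))"
      using assms by (simp add: nat_pow_inv inv_mult_group m_assoc)
    finally show ?thesis using norm_commutator[of c "x [^] k"] norm_inv assms by simp
  qed
  have "q z \<le> q \<one> + 0"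
    by (rule admissibleD(5)[OF q, where C = "2 * \<nu> c"]) (use z norm_z in simp_all)
  moreover have "q \<one> \<le> q z + 0"
    by (rule admissibleD(5)[OF q, where C = "2 * \<nu> c"]) (use z norm_z norm_inv in simp_all)
  ultimately show ?thesis using admissible_one[OF q] by (simp add: z_def)
qed

text \<open>The bound does not involve \<open>q\<close>, so pointwise infima over families of
  admissible functionals are finite.\<close>

lemma admissible_lower:
  assumes q: "admissible q" and x: "x \<in> carrier G"
  shows "- stab G \<nu> (inv x) \<le> q x"
  using admissibleD(3)[OF q, of x "inv x"] admissibleD(2)[OF q, of "inv x"] admissible_one[OF q] x
  by simp

section \<open>The Hahn-Banach step\<close>

definition far :: "'a \<Rightarrow> 'a \<Rightarrow> 'a \<Rightarrow> bool" where
  "far y x c \<longleftrightarrow> c \<in> carrier G \<and> x \<otimes> conj_by c y = conj_by c y \<otimes> x"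

text \<open>The counterpart of \<open>q (x + n y) - n q y\<close> from the linear Hahn-Banach
  theorem, with the far product in place of the sum and natural numbers in place of nonnegative
  reals.\<close>

definition gain :: "('a \<Rightarrow> real) \<Rightarrow> 'a \<Rightarrow> 'a \<Rightarrow> 'a \<Rightarrow> nat \<Rightarrow> real" where
  "gain q y x c n = q (x \<otimes> conj_by c y [^] n) - real n * q y"

text \<open>
  The step of the Hahn-Banach argument: a sublinear functional \<open>q\<close> with \<open>shift q y = q\<close> for all \<open>y\<close>
  is additive, and \<open>shift q y (inv y) \<le> - q y\<close>.
\<close>
definition shift :: "('a \<Rightarrow> real) \<Rightarrow> 'a \<Rightarrow> 'a \<Rightarrow> real" where
  "shift q y x = (if x \<in> carrier G then INF (c, n)\<in>{c. far y x c} \<times> UNIV. gain q y x c n else 0)"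

text \<open>A common conjugator allows gains at \<open>x\<close>, at \<open>x'\<close> and at their
  product to be compared.\<close>

lemma far_pair:
  assumes "y \<in> carrier G" "x \<in> carrier G" "x' \<in> carrier G"
  obtains c where "far y x c" "far y x' c" "far y (x \<otimes> x') c"
proof -
  obtain c where c: "c \<in> carrier G" "\<And>z. z \<in> set [x, x'] \<Longrightarrow> z \<otimes> conj_by c y = conj_by c y \<otimes> z"
    by (rule far_exists[of "[x, x']" y]) (use assms in auto)
  then show ?thesis using that[of c] assms commute_mult[of x x' "conj_by c y"] by (simp add: far_def)
qed

lemma far_pow:
  assumes "far y x c" "x \<in> carrier G" "y \<in> carrier G"
  shows "far y (x [^] (m::nat)) c"
  using assms commute_pow[of x "conj_by c y" m] by (simp add: far_def)

lemma far_commute_pow: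
  assumes "far y x c" "x \<in> carrier G" "y \<in> carrier G"
  shows "x \<otimes> conj_by c y [^] (n::nat) = conj_by c y [^] n \<otimes> x"
  using assms commute_pow[of "conj_by c y" x n] by (simp add: far_def)

text \<open>The common factor \<open>w\<close> commutes with \<open>x\<close> and \<open>x'\<close>,
  so it cancels in the quotient of the \<open>k\<close>-th powers.\<close>

lemma gain_close:
  assumes q: "admissible q" and G: "y \<in> carrier G" "x \<in> carrier G" "x' \<in> carrier G"
    and far: "far y x c" "far y x' c"
    and le: "\<And>k::nat. \<nu> (x [^] k \<otimes> inv (x' [^] k)) \<le> B * real k + C"
  shows "gain q y x c n \<le> gain q y x' c n + B"
proof -
  have c: "c \<in> carrier G" using far by (simp add: far_def)
  define w where "w = conj_by c y [^] n"
  have w: "w \<in> carrier G" using c G by (simp add: w_def)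
  have comm: "x \<otimes> w = w \<otimes> x" "x' \<otimes> w = w \<otimes> x'"
    using far_commute_pow far G by (simp_all add: w_def)
  have "(x \<otimes> w) [^] k \<otimes> inv ((x' \<otimes> w) [^] k) = x [^] k \<otimes> inv (x' [^] k)" for k :: nat
    using w G by (simp add: pow_mult_distrib[OF comm(1)] pow_mult_distrib[OF comm(2)] inv_mult_group m_assoc)
  then have "q (x \<otimes> w) \<le> q (x' \<otimes> w) + B"
    using G w le by (intro admissibleD(5)[OF q, where C = C]) simp_all
  then show ?thesis by (simp add: gain_def w_def)
qed

text \<open>Up to conjugation by a power of \<open>x\<close>, the quotient of the
  \<open>k\<close>-th powers compares two conjugates of the same \<open>Y\<close>. Both are close to
  \<open>Y\<close>, with a bound independent of \<open>k\<close>.\<close>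

lemma gain_indep:
  assumes q: "admissible q" and G: "y \<in> carrier G" "x \<in> carrier G"
    and far: "far y x c" "far y x c'"
  shows "gain q y x c n \<le> gain q y x c' n"
proof -
  have c: "c \<in> carrier G" "c' \<in> carrier G" using far by (simp_all add: far_def)
  define w where "w = conj_by c y [^] n"
  define w' where "w' = conj_by c' y [^] n"
  have w: "w \<in> carrier G" "w' \<in> carrier G" using c G by (simp_all add: w_def w'_def)
  have comm: "x \<otimes> w = w \<otimes> x" "x \<otimes> w' = w' \<otimes> x"
    using far_commute_pow far G by (simp_all add: w_def w'_def)
  have "\<nu> ((x \<otimes> w) [^] k \<otimes> inv ((x \<otimes> w') [^] k)) \<le> 0 * real k + (2 * \<nu> c + 2 * \<nu> c')" for k :: nat
  proof -
    define Y where "Y = y [^] (n * k)"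
    have Y: "Y \<in> carrier G" using G by (simp add: Y_def)
    have wk: "w [^] k = conj_by c Y" "w' [^] k = conj_by c' Y"
      using c G by (simp_all add: w_def w'_def Y_def conj_by_pow nat_pow_pow)
    have "(x \<otimes> w) [^] k \<otimes> inv ((x \<otimes> w') [^] k) = conj_by (x [^] k) (w [^] k \<otimes> inv (w' [^] k))"
      using w G by (simp add: pow_mult_distrib[OF comm(1)] pow_mult_distrib[OF comm(2)] inv_mult_group m_assoc)
    then have "\<nu> ((x \<otimes> w) [^] k \<otimes> inv ((x \<otimes> w') [^] k)) = \<nu> (w [^] k \<otimes> inv (w' [^] k))"
      using norm_conj w G by simp
    also have "\<dots> \<le> \<nu> (w [^] k \<otimes> inv Y) + \<nu> (Y \<otimes> inv (w' [^] k))"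
      by (rule norm_triangle) (use w Y in simp_all)
    also have "\<nu> (w [^] k \<otimes> inv Y) \<le> 2 * \<nu> c" unfolding wk by (rule norm_commutator) (use c Y in simp_all)
    also have "\<nu> (Y \<otimes> inv (w' [^] k)) \<le> 2 * \<nu> c'"
      using norm_commutator[of c' Y] norm_sym[of Y "w' [^] k"] c Y w by (simp add: wk)
    finally show ?thesis by simp
  qed
  then have "q (x \<otimes> w) \<le> q (x \<otimes> w') + 0"
    using G w by (intro admissibleD(5)[OF q]) simp_all
  then show ?thesis by (simp add: gain_def w_def w'_def)
qed

text \<open>Subadditivity for \<open>inv x\<close> and \<open>x \<otimes> w\<close>, whose product
  \<open>w\<close> has value \<open>n * q y\<close>. The bound is independent of \<open>c\<close>
  and \<open>n\<close>, so the infimum in \<open>shift\<close> is finite.\<close>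

lemma gain_lower:
  assumes q: "admissible q" and G: "y \<in> carrier G" "x \<in> carrier G" and far: "far y x c"
  shows "- q (inv x) \<le> gain q y x c n"
proof -
  have c: "c \<in> carrier G" using far by (simp add: far_def)
  define w where "w = conj_by c y [^] n"
  have w: "w \<in> carrier G" using c G by (simp add: w_def)
  have comm: "x \<otimes> w = w \<otimes> x" using far_commute_pow far G by (simp add: w_def)
  have "inv x \<otimes> (x \<otimes> w) = w" using G w by simp
  moreover have "(x \<otimes> w) \<otimes> inv x = w" using G w by (simp add: comm m_assoc)
  ultimately have "q w \<le> q (inv x) + q (x \<otimes> w)"
    using admissibleD(3)[OF q, of "inv x" "x \<otimes> w"] G w by simp
  moreover have "q w = real n * q y"
    using admissibleD(4)[OF q] admissible_conj[OF q] c G by (simp add: w_def)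
  ultimately show ?thesis by (simp add: gain_def w_def)
qed

lemma gain_pow:
  assumes q: "admissible q" and G: "y \<in> carrier G" "x \<in> carrier G" and far: "far y x c"
  shows "gain q y (x [^] m) c (n * m) = real m * gain q y x c n"
proof -
  have c: "c \<in> carrier G" using far by (simp add: far_def)
  have "x [^] m \<otimes> conj_by c y [^] (n * m) = (x \<otimes> conj_by c y [^] n) [^] m"
    using c G pow_mult_distrib[OF far_commute_pow[OF far], of n m] by (simp add: nat_pow_pow)
  then show ?thesis
    using admissibleD(4)[OF q, of "x \<otimes> conj_by c y [^] n" m] c G by (simp add: gain_def algebra_simps)
qed

text \<open>Since all factors involved commute, the product regroups as \<open>x \<otimes> w\<close>
  times \<open>x' \<otimes> w'\<close>, to which subadditivity of \<open>q\<close> applies.\<close>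

lemma gain_add:
  assumes q: "admissible q" and G: "y \<in> carrier G" "x \<in> carrier G" "x' \<in> carrier G"
    and comm: "x \<otimes> x' = x' \<otimes> x" and far: "far y x c" "far y x' c"
  shows "gain q y (x \<otimes> x') c (n + n') \<le> gain q y x c n + gain q y x' c n'"
proof -
  have c: "c \<in> carrier G" using far by (simp add: far_def)
  define w where "w = conj_by c y [^] n"
  define w' where "w' = conj_by c y [^] n'"
  have w: "w \<in> carrier G" "w' \<in> carrier G" using c G by (simp_all add: w_def w'_def)
  have ww: "w \<otimes> w' = conj_by c y [^] (n + n')" "w \<otimes> w' = w' \<otimes> w"
    using c G by (simp_all add: w_def w'_def nat_pow_mult add.commute)
  have xw: "x \<otimes> w = w \<otimes> x" "x \<otimes> w' = w' \<otimes> x" "x' \<otimes> w = w \<otimes> x'" "x' \<otimes> w' = w' \<otimes> x'"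
    using far_commute_pow far G by (simp_all add: w_def w'_def)
  have x'ww: "x' \<otimes> (w \<otimes> w') = w \<otimes> (x' \<otimes> w')" using w G xw(3) by (metis m_assoc)
  then have eq: "(x \<otimes> x') \<otimes> (w \<otimes> w') = (x \<otimes> w) \<otimes> (x' \<otimes> w')" using w G by (simp add: m_assoc)
  have "(x \<otimes> w) \<otimes> z = z \<otimes> (x \<otimes> w)" if "z = x' \<or> z = w'" for z
    by (rule commute_mult) (use that w G comm xw ww in auto)
  then have "(x' \<otimes> w') \<otimes> (x \<otimes> w) = (x \<otimes> w) \<otimes> (x' \<otimes> w')"
    by (intro commute_mult) (use w G in auto)
  then have "q ((x \<otimes> w) \<otimes> (x' \<otimes> w')) \<le> q (x \<otimes> w) + q (x' \<otimes> w')"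
    using w G by (intro admissibleD(3)[OF q]) simp_all
  then have "q ((x \<otimes> x') \<otimes> (w \<otimes> w')) \<le> q (x \<otimes> w) + q (x' \<otimes> w')" by (simp only: eq)
  then show ?thesis unfolding ww(1) by (simp add: gain_def w_def w'_def algebra_simps)
qed

lemma shift_le:
  assumes "admissible q" "y \<in> carrier G" "x \<in> carrier G" "far y x c"
  shows "shift q y x \<le> gain q y x c n"
proof -
  have "bdd_below ((\<lambda>(c, n). gain q y x c n) ` ({c. far y x c} \<times> UNIV))"
    by (rule bdd_belowI[of _ "- q (inv x)"]) (use gain_lower assms in auto)
  from cINF_lower[OF this, of "(c, n)"] show ?thesis using assms by (simp add: shift_def)
qed

lemma le_shift:
  assumes "y \<in> carrier G" "x \<in> carrier G" "\<And>c n. far y x c \<Longrightarrow> r \<le> gain q y x c n"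
  shows "r \<le> shift q y x"
proof -
  obtain c where "far y x c" by (rule far_pair[OF assms(1,2,2)])
  then have "{c. far y x c} \<times> (UNIV :: nat set) \<noteq> {}" by blast
  from cINF_greatest[OF this, of r "\<lambda>(c, n). gain q y x c n"] show ?thesis
    using assms by (auto simp: shift_def)
qed

text \<open>The candidate \<open>n = 0\<close> of the infimum is \<open>q x\<close> itself.\<close>

lemma shift_below:
  assumes "admissible q" "y \<in> carrier G"
  shows "shift q y x \<le> q x"
proof (cases "x \<in> carrier G")
  case True
  obtain c where "far y x c" by (rule far_pair[OF assms(2) True True])
  then show ?thesis using shift_le[OF assms True, of c 0] True by (simp add: gain_def)
qed (use assms in \<open>simp add: shift_def admissibleD(1)\<close>)

text \<open>Each clause holds for gains taken with one suitable conjugator; independence of the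
  conjugator carries it over to the infimum.\<close>

lemma admissible_shift:
  assumes q: "admissible q" and y: "y \<in> carrier G"
  shows "admissible (shift q y)"
proof -
  have sub: "shift q y (x \<otimes> x') \<le> shift q y x + shift q y x'"
    if x: "x \<in> carrier G" "x' \<in> carrier G" "x \<otimes> x' = x' \<otimes> x" for x x'
  proof -
    have *: "shift q y (x \<otimes> x') \<le> gain q y x d n + gain q y x' d' n'"
      if d: "far y x d" "far y x' d'" for d d' n n'
    proof -
      obtain c where c: "far y x c" "far y x' c" "far y (x \<otimes> x') c"
        by (rule far_pair[OF y x(1,2)])
      have "shift q y (x \<otimes> x') \<le> gain q y (x \<otimes> x') c (n + n')"
        using shift_le[OF q y _ c(3)] x by simp
      also have "\<dots> \<le> gain q y x c n + gain q y x' c n'" by (rule gain_add[OF q y x c(1,2)])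
      also have "\<dots> \<le> gain q y x d n + gain q y x' d' n'"
        by (intro add_mono gain_indep q y x c d)
      finally show ?thesis .
    qed
    \<comment> \<open>The two infima are taken one after the other, with the other term moved to the
      left.\<close>
    have "shift q y (x \<otimes> x') - gain q y x' d' n' \<le> shift q y x" if "far y x' d'" for d' n'
      by (rule le_shift[OF y x(1)]) (use *[OF _ that] in \<open>simp add: algebra_simps\<close>)
    then have "shift q y (x \<otimes> x') - shift q y x \<le> shift q y x'"
      by (intro le_shift[OF y x(2)]) (simp add: algebra_simps)
    then show ?thesis by simp
  qed
  have hom: "shift q y (x [^] m) = real m * shift q y x" if x: "x \<in> carrier G" for x and m :: nat
  proof (cases "m = 0")
    case True
    obtain c where c: "far y \<one> c" by (rule far_pair[OF y one_closed one_closed])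
    have "0 \<le> shift q y \<one>"
      by (rule le_shift[OF y one_closed]) (use gain_lower[OF q y one_closed] admissible_one[OF q] in fastforce)
    with True show ?thesis using shift_below[OF q y, of \<one>] admissible_one[OF q] by simp
  next
    case False
    \<comment> \<open>A conjugator \<open>d\<close> for \<open>x [^] m\<close> need not make the
      conjugate of \<open>y\<close> commute with \<open>x\<close>, so \<open>gain_pow\<close> is
      applied with \<open>c\<close> and the result transferred to \<open>d\<close>.\<close>
    obtain c where c: "far y x c" by (rule far_pair[OF y x x])
    have "real m * shift q y x \<le> shift q y (x [^] m)"
    proof (rule le_shift[OF y])
      fix d n assume d: "far y (x [^] m) d"
      have "real m * shift q y x \<le> real m * gain q y x c n"
        using shift_le[OF q y x c] by (intro mult_left_mono) simp_all
      also have "\<dots> = gain q y (x [^] m) c (n * m)" by (rule gain_pow[OF q y x c, symmetric])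
      also have "\<dots> \<le> gain q y (x [^] m) d (n * m)" by (rule gain_indep[OF q y _ far_pow[OF c x y] d]) (use x in simp)
      also have "\<dots> \<le> gain q y (x [^] m) d n"
      proof -
        \<comment> \<open>The gain does not increase with \<open>n\<close>: the \<open>j\<close>
          additional copies of \<open>y\<close> are attached to \<open>\<one>\<close>, where the
          gain is 0. Here \<open>m > 0\<close> ensures \<open>n \<le> n * m\<close>.\<close>
        obtain j where j: "n * m = n + j" using False le_iff_add[of n "n * m"] by auto
        have "far y \<one> d" using d y by (simp add: far_def)
        from gain_add[OF q y _ one_closed _ d this, of n j] have
          "gain q y (x [^] m) d (n + j) \<le> gain q y (x [^] m) d n + gain q y \<one> d j" using x by simp
        moreover have "gain q y \<one> d j = 0"
          using admissibleD(4)[OF q] admissible_conj[OF q] d y by (simp add: gain_def far_def)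
        ultimately show ?thesis by (simp add: j)
      qed
      finally show "real m * shift q y x \<le> gain q y (x [^] m) d n" .
    qed (use x in simp)
    moreover have "shift q y (x [^] m) / real m \<le> shift q y x"
    proof (rule le_shift[OF y x])
      fix d n assume d: "far y x d"
      have "shift q y (x [^] m) \<le> real m * gain q y x d n"
        using shift_le[OF q y _ far_pow[OF d x y], of m "n * m"] x gain_pow[OF q y x d] by simp
      then show "shift q y (x [^] m) / real m \<le> gain q y x d n" using False by (simp add: field_simps)
    qed
    ultimately show ?thesis using False by (simp add: field_simps)
  qed
  have close: "shift q y x \<le> shift q y x' + B"
    if x: "x \<in> carrier G" "x' \<in> carrier G"
      and le: "\<forall>k::nat. \<nu> (x [^] k \<otimes> inv (x' [^] k)) \<le> B * real k + C" for x x' B C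
  proof -
    obtain c where c: "far y x c" "far y x' c" by (rule far_pair[OF y x])
    have "shift q y x - B \<le> shift q y x'"
    proof (rule le_shift[OF y x(2)])
      fix d n assume d: "far y x' d"
      have "shift q y x \<le> gain q y x c n" by (rule shift_le[OF q y x(1) c(1)])
      also have "\<dots> \<le> gain q y x' c n + B" by (rule gain_close[OF q y x c]) (use le in blast)
      also have "gain q y x' c n \<le> gain q y x' d n" by (rule gain_indep[OF q y x(2) c(2) d])
      finally show "shift q y x - B \<le> gain q y x' d n" by simp
    qed
    then show ?thesis by simp
  qed
  show ?thesis unfolding admissible_def
  proof (intro conjI)
    show "\<forall>x\<in>carrier G. shift q y x \<le> stab G \<nu> x"
      using shift_below[OF q y] admissibleD(2)[OF q] order_trans by blast
  qed (simp add: shift_def, use sub in blast, use hom in blast, use close in blast)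
qed

section \<open>Minimal admissible functionals and additivity\<close>

lemma admissible_chain_INF:
  assumes ne: "C \<noteq> {}" and adm: "\<And>q. q \<in> C \<Longrightarrow> admissible q"
    and chain: "\<And>q r. q \<in> C \<Longrightarrow> r \<in> C \<Longrightarrow> q \<le> r \<or> r \<le> q"
  shows "admissible (\<lambda>x. INF q\<in>C. q x) \<and> (\<forall>q\<in>C. (\<lambda>x. INF q\<in>C. q x) \<le> q)"
proof -
  define u where "u = (\<lambda>x. INF q\<in>C. q x)"
  have zero: "q x = 0" if "q \<in> C" "x \<notin> carrier G" for q x
    using admissibleD(1)[OF adm] that by blast
  have bdd: "bdd_below ((\<lambda>q. q x) ` C)" for x
  proof (cases "x \<in> carrier G")
    case True
    then show ?thesis using admissible_lower[OF adm]
      by (intro bdd_belowI[of _ "- stab G \<nu> (inv x)"]) auto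
  next
    case False
    show ?thesis
    proof (rule bdd_belowI)
      fix r assume "r \<in> (\<lambda>q. q x) ` C"
      then obtain q where "q \<in> C" "r = q x" by blast
      then show "0 \<le> r" using zero[OF _ False, of q] by simp
    qed
  qed
  have u_le: "u x \<le> q x" if "q \<in> C" for q x
    unfolding u_def using cINF_lower[OF bdd that] by simp
  have le_u: "r \<le> u x" if "\<And>q. q \<in> C \<Longrightarrow> r \<le> q x" for r x
    unfolding u_def by (rule cINF_greatest[OF ne that])
  obtain q0 where q0: "q0 \<in> C" using ne by blast
  have below: "u x \<le> stab G \<nu> x" if "x \<in> carrier G" for x
    using order_trans[OF u_le[OF q0] admissibleD(2)[OF adm[OF q0] that]] .
  have sub: "u (x \<otimes> y) \<le> u x + u y"
    if x: "x \<in> carrier G" "y \<in> carrier G" "x \<otimes> y = y \<otimes> x" for x y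
  proof -
    have *: "u (x \<otimes> y) \<le> q x + r y" if C: "q \<in> C" "r \<in> C" for q r
    proof -
      \<comment> \<open>Subadditivity survives the infimum because two members of a chain have a
        common lower bound in it.\<close>
      obtain t where t: "t \<in> C" "t \<le> q" "t \<le> r" using chain[OF C] C by blast
      have "u (x \<otimes> y) \<le> t x + t y"
        using order_trans[OF u_le[OF t(1)] admissibleD(3)[OF adm[OF t(1)] x]] .
      also have "\<dots> \<le> q x + r y" using t by (intro add_mono) (simp_all add: le_fun_def)
      finally show ?thesis .
    qed
    have "u (x \<otimes> y) - r y \<le> u x" if "r \<in> C" for r
      by (rule le_u) (use *[OF _ that] in \<open>simp add: algebra_simps\<close>)
    then have "u (x \<otimes> y) - u x \<le> u y" by (intro le_u) (simp add: algebra_simps)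
    then show ?thesis by simp
  qed
  have hom: "u (x [^] n) = real n * u x" if x: "x \<in> carrier G" for x and n :: nat
  proof (cases "n = 0")
    case True
    have "u \<one> = 0"
    proof (rule antisym)
      show "u \<one> \<le> 0" using u_le[OF q0, of \<one>] admissible_one[OF adm[OF q0]] by simp
      show "0 \<le> u \<one>"
      proof (rule le_u)
        fix q assume "q \<in> C"
        then show "0 \<le> q \<one>" using admissible_one[OF adm, of q] by simp
      qed
    qed
    then show ?thesis using True by simp
  next
    case False
    have "u (x [^] n) / real n \<le> u x"
    proof (rule le_u)
      fix q assume "q \<in> C"
      then have "u (x [^] n) \<le> real n * q x"
        using u_le[of q "x [^] n"] admissibleD(4)[OF adm x] by simp
      then show "u (x [^] n) / real n \<le> q x" using False by (simp add: field_simps)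
    qed
    moreover have "real n * u x \<le> u (x [^] n)"
    proof (rule le_u)
      fix q assume "q \<in> C"
      then show "real n * u x \<le> q (x [^] n)"
        using u_le[of q x] admissibleD(4)[OF adm x, of q n] by (simp add: mult_left_mono)
    qed
    ultimately show ?thesis using False by (simp add: field_simps)
  qed
  have close: "u x \<le> u y + B"
    if x: "x \<in> carrier G" "y \<in> carrier G"
      and le: "\<forall>k::nat. \<nu> (x [^] k \<otimes> inv (y [^] k)) \<le> B * real k + D" for x y B D
  proof -
    have "u x - B \<le> q y" if "q \<in> C" for q
    proof -
      have "q x \<le> q y + B" by (rule admissibleD(5)[OF adm[OF that] x]) (use le in blast)
      then show ?thesis using u_le[OF that, of x] by simp
    qed
    then have "u x - B \<le> u y" by (rule le_u)
    then show ?thesis by simp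
  qed
  have "admissible u" unfolding admissible_def
  proof (intro conjI)
    have "u x = 0" if x: "x \<notin> carrier G" for x
    proof (rule antisym)
      show "u x \<le> 0" using u_le[OF q0, of x] zero[OF q0 x] by simp
      show "0 \<le> u x"
      proof (rule le_u)
        fix q assume "q \<in> C"
        then show "0 \<le> q x" using zero[of q, OF _ x] by simp
      qed
    qed
    then show "\<forall>x. x \<notin> carrier G \<longrightarrow> u x = 0" by blast
  qed (use below in blast, use sub in blast, use hom in blast, use close in blast)
  then show ?thesis using u_le by (auto simp: le_fun_def u_def)
qed

lemma exists_minimal_admissible:
  assumes "admissible p"
  obtains q where "admissible q" "q \<le> p" "\<And>r. admissible r \<Longrightarrow> r \<le> q \<Longrightarrow> r = q"
proof -
  define A where "A = {q. admissible q \<and> q \<le> p}"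
  have "\<exists>m\<in>A. \<forall>a\<in>A. a \<le> m \<longrightarrow> a = m"
  \<comment> \<open>The order is reversed, so that the maximal element given by Zorn's lemma is a
    minimal functional.\<close>
  proof (rule predicate_Zorn[where P = "\<lambda>a b. b \<le> a"])
    show "partial_order_on A (relation_of (\<lambda>a b. b \<le> a) A)"
      by (rule partial_order_on_relation_ofI) auto
    fix C assume C: "C \<in> Chains (relation_of (\<lambda>a b. b \<le> a) A)"
    show "\<exists>u\<in>A. \<forall>a\<in>C. u \<le> a"
    proof (cases "C = {}")
      case True
      then show ?thesis using assms by (auto simp: A_def)
    next
      case False
      have CA: "q \<in> A" if "q \<in> C" for q using C that by (auto simp: Chains_def relation_of_def)
      have chain: "q \<le> r \<or> r \<le> q" if "q \<in> C" "r \<in> C" for q r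
        using C that by (auto simp: Chains_def relation_of_def)
      have *: "admissible (\<lambda>x. INF q\<in>C. q x) \<and> (\<forall>q\<in>C. (\<lambda>x. INF q\<in>C. q x) \<le> q)"
        by (rule admissible_chain_INF[OF False _ chain]) (use CA in \<open>auto simp: A_def\<close>)
      obtain q0 where "q0 \<in> C" using False by blast
      then have "(\<lambda>x. INF q\<in>C. q x) \<le> p" using * CA[of q0] order_trans unfolding A_def by blast
      then show ?thesis using * by (intro bexI[of _ "\<lambda>x. INF q\<in>C. q x"]) (auto simp: A_def)
    qed
  qed
  then obtain m where "m \<in> A" "\<forall>a\<in>A. a \<le> m \<longrightarrow> a = m" by blast
  then show ?thesis using that[of m] order_trans[of _ m p] unfolding A_def by blast
qed

text \<open>Minimality yields additivity. Starting below \<open>shift p g\<close> rather than below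
  \<open>p\<close> pins the value at \<open>g\<close>: it forces
  \<open>q (inv g) \<le> - p g\<close>, hence \<open>q g\<close> cannot drop below the
  stabilization.\<close>

lemma exists_additive_functional:
  assumes g: "g \<in> carrier G"
  obtains q where "admissible q" "q g = stab G \<nu> g"
    "\<And>x y c. x \<in> carrier G \<Longrightarrow> y \<in> carrier G \<Longrightarrow> far y x c \<Longrightarrow> q (x \<otimes> conj_by c y) = q x + q y"
proof -
  define p where "p = (\<lambda>x. if x \<in> carrier G then stab G \<nu> x else 0)"
  have p: "admissible p" unfolding p_def by (rule admissible_stab)
  obtain q where q: "admissible q" "q \<le> shift p g" "\<And>r. admissible r \<Longrightarrow> r \<le> q \<Longrightarrow> r = q"
    by (rule exists_minimal_admissible[OF admissible_shift[OF p g]]) blast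
  have add: "q (x \<otimes> conj_by c y) = q x + q y"
    if x: "x \<in> carrier G" "y \<in> carrier G" "far y x c" for x y c
  proof (rule antisym)
    have c: "c \<in> carrier G" "x \<otimes> conj_by c y = conj_by c y \<otimes> x" using x by (simp_all add: far_def)
    then show "q (x \<otimes> conj_by c y) \<le> q x + q y"
      using admissibleD(3)[OF q(1), of x "conj_by c y"] admissible_conj[OF q(1), of c y] x by simp
    \<comment> \<open>By minimality the shift leaves \<open>q\<close> unchanged; the candidate
      \<open>n = 1\<close> of its infimum is then the missing superadditivity.\<close>
    have "shift q y \<le> q" using shift_below[OF q(1) x(2)] by (simp add: le_fun_def)
    then have "shift q y = q" by (rule q(3)[OF admissible_shift[OF q(1) x(2)]])
    then show "q x + q y \<le> q (x \<otimes> conj_by c y)"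
      using shift_le[OF q(1) x(2,1,3), of 1] x c by (simp add: gain_def)
  qed
  obtain c where c: "far (inv g) g c" by (rule far_pair[of "inv g" g g]) (use g in auto)
  have "q (inv g) = - q g"
    using add[OF g inv_closed[OF g] c] admissible_cancel[OF q(1), of c g] c g by (simp add: far_def)
  \<comment> \<open>The candidate \<open>n = 1\<close> suffices, because \<open>p\<close> vanishes
    on the far product of \<open>inv g\<close> and \<open>g\<close>.\<close>
  moreover have "q (inv g) \<le> - p g"
  proof -
    obtain d where d: "far g (inv g) d" by (rule far_pair[of g "inv g" "inv g"]) (use g in auto)
    have "q (inv g) \<le> shift p g (inv g)" using q(2) by (simp add: le_fun_def)
    also have "\<dots> \<le> gain p g (inv g) d 1" by (rule shift_le[OF p g _ d]) (use g in simp)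
    also have "\<dots> = - p g"
      using admissible_cancel[OF p, of d "inv g"] d g by (simp add: gain_def far_def)
    finally show ?thesis .
  qed
  ultimately have "q g = stab G \<nu> g" using admissibleD(2)[OF q(1) g] g by (simp add: p_def)
  then show ?thesis using that q(1) add by blast
qed

end

section \<open>From far additivity to the quasimorphism inequality\<close>

locale additive_functional = FM_normed_group G \<nu> for G (structure) and \<nu> +
  fixes q :: "'a \<Rightarrow> real"
  assumes adm: "admissible q"
    and additive: "\<And>x y c. x \<in> carrier G \<Longrightarrow> y \<in> carrier G \<Longrightarrow> far y x c \<Longrightarrow> q (x \<otimes> conj_by c y) = q x + q y"
begin

text \<open>Additivity on the far product of \<open>x\<close> and \<open>inv x\<close>, on which
  \<open>q\<close> vanishes.\<close>

lemma functional_inv: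
  assumes x: "x \<in> carrier G"
  shows "q (inv x) = - q x"
proof -
  obtain c where c: "far (inv x) x c" by (rule far_pair[of "inv x" x x]) (use x in auto)
  then show ?thesis
    using additive[OF x inv_closed[OF x] c] admissible_cancel[OF adm, of c x] x by (simp add: far_def)
qed

lemma functional_homogeneous: "homogeneous G q"
  unfolding homogeneous_def
proof (intro ballI allI)
  fix f and n :: int assume f: "f \<in> carrier G"
  show "q (f [^] n) = real_of_int n * q f"
  proof (cases n rule: int_cases2)
    case (nonneg m)
    then show ?thesis using admissibleD(4)[OF adm f, of m] by (simp add: int_pow_int)
  next
    case (nonpos m)
    then show ?thesis
      using admissibleD(4)[OF adm f, of m] functional_inv[of "f [^] m"] f by (simp add: int_pow_neg_int)
  qed
qed

lemma functional_commute:
  assumes "x \<in> carrier G" "y \<in> carrier G"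
  shows "q (x \<otimes> y) = q (y \<otimes> x)"
  using admissible_conj[OF adm, of "inv x" "x \<otimes> y"] assms by (simp add: m_assoc)

text \<open>After replacing \<open>f\<close> by a conjugate \<open>w\<close> that commutes with
  \<open>g\<close>, additivity is exact. The replacement moves the product by at most
  \<open>2 * \<nu> h0\<close> in norm, its \<open>k\<close>-th power by at most \<open>k\<close>
  times that, and hence the value of \<open>q\<close> by at most
  \<open>2 * \<nu> h0\<close>.\<close>

lemma functional_mult_left:
  assumes H: "c_generated G H" "H \<subseteq> carrier G" and h0: "h0 \<in> far_displacers G H H"
    and f: "f \<in> H" and g: "g \<in> carrier G"
  shows "\<bar>q (f \<otimes> g) - q f - q g\<bar> \<le> 2 * \<nu> h0"
proof -
  have G: "f \<in> carrier G" "h0 \<in> carrier G" using f H(2) h0 by (auto simp: far_displacers_def)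
  obtain h where h: "h \<in> carrier G"
    "\<And>x. x \<in> set [g] \<Longrightarrow> x \<otimes> conj_by (conj_by h h0) (foldr (\<otimes>) [f] \<one>)
                          = conj_by (conj_by h h0) (foldr (\<otimes>) [f] \<one>) \<otimes> x"
    by (rule displacement[OF H(1,2,2) h0, of "[f]" "[g]"]) (use f g in auto)
  define c where "c = conj_by h h0"
  have c: "c \<in> carrier G" "\<nu> c = \<nu> h0" using norm_conj h G by (simp_all add: c_def)
  have far: "far f g c" using h(2) c(1) G by (simp add: far_def c_def)
  define w where "w = conj_by c f"
  have w: "w \<in> carrier G" using c G by (simp add: w_def)
  have "q (w \<otimes> g) = q f + q g"
    using additive[OF g G(1) far] far by (simp add: far_def w_def)
  moreover have close: "q (x \<otimes> g) \<le> q (y \<otimes> g) + 2 * \<nu> h0"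
    if xy: "x \<in> carrier G" "y \<in> carrier G" "\<nu> (x \<otimes> inv y) \<le> 2 * \<nu> h0" for x y
  proof (rule admissibleD(5)[OF adm])
    fix k :: nat
    have "(x \<otimes> g) \<otimes> inv (y \<otimes> g) = x \<otimes> inv y" using xy g by (simp add: inv_mult_group m_assoc)
    then have "\<nu> ((x \<otimes> g) [^] k \<otimes> inv ((y \<otimes> g) [^] k)) \<le> real k * \<nu> (x \<otimes> inv y)"
      using norm_pow_dist[of "x \<otimes> g" "y \<otimes> g" k] xy g by simp
    also have "\<dots> \<le> 2 * \<nu> h0 * real k + 0" using mult_left_mono[OF xy(3), of "real k"] by (simp add: mult.commute)
    finally show "\<nu> ((x \<otimes> g) [^] k \<otimes> inv ((y \<otimes> g) [^] k)) \<le> 2 * \<nu> h0 * real k + 0" .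
  qed (use xy g in simp_all)
  have wf: "\<nu> (w \<otimes> inv f) \<le> 2 * \<nu> h0" using norm_commutator[of c f] c G by (simp add: w_def)
  ultimately show ?thesis
    using close[OF w G(1) wf] close[OF G(1) w] wf norm_sym[OF w G(1)] by simp
qed

text \<open>Conjugation invariance of \<open>q\<close> moves the first factor into \<open>H\<close>;
  the infimum over all displacers then gives the energy.\<close>

lemma functional_mult_conj:
  assumes H: "c_generated G H" "H \<subseteq> carrier G" and ne: "far_displacers G H H \<noteq> {}"
    and f: "f \<in> conjugates G H" and g: "g \<in> carrier G"
  shows "\<bar>q (f \<otimes> g) - q f - q g\<bar> \<le> 2 * fa_energy G H \<nu> H"
proof -
  obtain a h where a: "a \<in> carrier G" "h \<in> H" "f = conj_by a h" using f by (auto simp: conjugates_def)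
  have hG: "h \<in> carrier G" using a H by blast
  define g' where "g' = conj_by (inv a) g"
  have g': "g' \<in> carrier G" "g = conj_by a g'" using a g by (simp_all add: g'_def m_assoc)
  have "f \<otimes> g = conj_by a (h \<otimes> g')" using a hG g' by (simp add: conj_by_mult)
  then have eq: "q (f \<otimes> g) - q f - q g = q (h \<otimes> g') - q h - q g'"
    using admissible_conj[OF adm] a hG g' by simp
  have "\<bar>q (f \<otimes> g) - q f - q g\<bar> / 2 \<le> (INF h0\<in>far_displacers G H H. \<nu> h0)"
    by (intro cINF_greatest[OF ne])
      (use functional_mult_left[OF H _ a(2) g'(1)] in \<open>simp add: eq mult.commute\<close>)
  then show ?thesis by (simp add: fa_energy_def)
qed

text \<open>Splitting off a factor \<open>x\<close> uses the previous bound twice, once in front of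
  \<open>F \<otimes> g\<close> and once in front of \<open>F\<close>, which costs four energies per
  factor.\<close>

lemma functional_mult_frag:
  assumes H: "c_generated G H" "H \<subseteq> carrier G" and ne: "far_displacers G H H \<noteq> {}"
    and "set xs \<subseteq> conjugates G H" and g: "g \<in> carrier G"
  shows "\<bar>q (foldr (\<otimes>) xs \<one> \<otimes> g) - q (foldr (\<otimes>) xs \<one>) - q g\<bar> \<le> 4 * fa_energy G H \<nu> H * real (length xs)"
  using assms(4)
proof (induction xs)
  case Nil
  then show ?case using g admissible_one[OF adm] by simp
next
  case (Cons x xs)
  define F where "F = foldr (\<otimes>) xs \<one>"
  have xs: "set xs \<subseteq> carrier G" and x: "x \<in> conjugates G H" "x \<in> carrier G"
    using Cons.prems conjugates_carrier[OF H(2)] by auto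
  have F: "F \<in> carrier G" using conj_by_foldr[OF xs one_closed] by (simp add: F_def)
  have "\<bar>q (F \<otimes> g) - q F - q g\<bar> \<le> 4 * fa_energy G H \<nu> H * real (length xs)"
    using Cons by (simp add: F_def)
  moreover have "\<bar>q (x \<otimes> (F \<otimes> g)) - q x - q (F \<otimes> g)\<bar> \<le> 2 * fa_energy G H \<nu> H"
    using F g by (intro functional_mult_conj[OF H ne x(1)]) simp
  moreover have "\<bar>q (x \<otimes> F) - q x - q F\<bar> \<le> 2 * fa_energy G H \<nu> H"
    using F by (intro functional_mult_conj[OF H ne x(1)])
  moreover have eq: "foldr (\<otimes>) (x # xs) \<one> = x \<otimes> F" "x \<otimes> F \<otimes> g = x \<otimes> (F \<otimes> g)"
    using x F g by (simp_all add: F_def m_assoc)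
  moreover have "4 * fa_energy G H \<nu> H * real (length (x # xs))
      = 4 * fa_energy G H \<nu> H * real (length xs) + 4 * fa_energy G H \<nu> H" by (simp add: algebra_simps)
  ultimately show ?case unfolding eq by linarith
qed

text \<open>Fragmenting \<open>f\<close> gives the bound by its norm; since
  \<open>q (f \<otimes> g) = q (g \<otimes> f)\<close>, fragmenting \<open>g\<close> gives the other
  one, hence the minimum.\<close>

lemma functional_qm_bound:
  assumes H: "FM_pair G H" and C: "4 * fa_energy G H \<nu> H \<le> C"
  shows "qm_bound G H q C"
  unfolding qm_bound_def
proof (intro ballI)
  fix f g assume fg: "f \<in> carrier G" "g \<in> carrier G"
  have cg: "c_generated G H" and HG: "H \<subseteq> carrier G"
    using H by (auto simp: FM_pair_def subgroup.subset)
  \<comment> \<open>\<open>H\<close> is its own conjugate by \<open>\<one>\<close>, so property FM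
    for the list \<open>[\<one>]\<close> provides displacers of \<open>H\<close>.\<close>
  have "(\<lambda>y. \<one> \<otimes> y \<otimes> inv \<one>) ` H = H" using HG by (force simp: image_iff)
  then have ne: "far_displacers G H H \<noteq> {}"
    using H[unfolded FM_pair_def, THEN conjunct2, THEN conjunct2, rule_format, of "[\<one>]"] by simp
  have bound: "\<bar>q (x \<otimes> y) - q x - q y\<bar> \<le> C * real n"
    if x: "x \<in> carrier G" "y \<in> carrier G" "frag_norm G H x = enat n" for x y n
  proof -
    obtain xs where "set xs \<subseteq> conjugates G H" "x = foldr (\<otimes>) xs \<one>" "frag_norm G H x = enat (length xs)"
      by (rule c_generatedE[OF cg x(1)]) blast
    then have "\<bar>q (x \<otimes> y) - q x - q y\<bar> \<le> 4 * fa_energy G H \<nu> H * real n"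
      using functional_mult_frag[OF cg HG ne _ x(2)] x(3) by force
    then show ?thesis using mult_right_mono[OF C, of "real n"] by simp
  qed
  obtain m n where mn: "frag_norm G H f = enat m" "frag_norm G H g = enat n"
    using cg fg unfolding c_generated_def by (meson not_infinity_eq)
  have "\<bar>q (f \<otimes> g) - q f - q g\<bar> \<le> C * real (min m n)"
    using bound[OF fg mn(1)] bound[OF fg(2,1) mn(2)] functional_commute[OF fg]
    by (simp add: min_def algebra_simps)
  then show "ereal \<bar>q (f \<otimes> g) - q f - q g\<bar>
      \<le> ereal C * ereal_of_enat (min (frag_norm G H f) (frag_norm G H g))"
    by (simp add: mn)
qed

end

section \<open>Vanishing defect and the derived subgroup\<close>

lemma (in group) vanishes_on_derived:
  fixes q :: "'a \<Rightarrow> real"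
  assumes hom: "\<And>x y. x \<in> carrier G \<Longrightarrow> y \<in> carrier G \<Longrightarrow> q (x \<otimes> y) = q x + q y"
    and "g \<in> derived G (carrier G)"
  shows "q g = 0"
proof -
  have one: "q \<one> = 0" using hom[of \<one> \<one>] by simp
  have q_inv: "q (inv x) = - q x" if "x \<in> carrier G" for x using hom[of x "inv x"] one that by simp
  define S where "S = derived_set G (carrier G)"
  have S: "h \<in> carrier G" "q h = 0" if "h \<in> S" for h
    using that by (auto simp: S_def hom q_inv)
  have "g \<in> generate G S" using assms(2) by (simp add: S_def derived_def)
  then have "g \<in> carrier G \<and> q g = 0"
    by (induction rule: generate.induct) (auto simp: one q_inv hom S)
  then show ?thesis by simp
qed

text \<open>For fixed \<open>x\<close> and \<open>y\<close> the fragmentation norms are finite, so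
  the error is at most \<open>C\<close> times a fixed number, with \<open>C\<close> below any
  positive bound.\<close>

lemma (in group) hom_if_small_defect:
  assumes cg: "c_generated G H" and xy: "x \<in> carrier G" "y \<in> carrier G"
    and small: "\<And>e. e > 0 \<Longrightarrow> \<exists>C<e. qm_bound G H q C"
  shows "q (x \<otimes> y) = q x + q y"
proof -
  obtain m n where mn: "frag_norm G H x = enat m" "frag_norm G H y = enat n"
    using cg xy unfolding c_generated_def by (meson not_infinity_eq)
  have "\<bar>q (x \<otimes> y) - q x - q y\<bar> \<le> 0 + e" if "e > 0" for e
  proof -
    \<comment> \<open>The added 1 keeps the denominator positive when one of the norms is 0.\<close>
    have "e / (real (min m n) + 1) > 0" using that by (intro divide_pos_pos add_nonneg_pos) simp_all
    then obtain C where C: "C < e / (real (min m n) + 1)" "qm_bound G H q C"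
      using small by blast
    have "\<bar>q (x \<otimes> y) - q x - q y\<bar> \<le> C * real (min m n)"
      using C(2) xy unfolding qm_bound_def by (force simp: mn)
    also have "\<dots> \<le> e / (real (min m n) + 1) * real (min m n)"
      using C(1) by (intro mult_right_mono) simp_all
    also have "\<dots> \<le> e" using that by (simp add: field_simps)
    finally show ?thesis by simp
  qed
  then have "\<bar>q (x \<otimes> y) - q x - q y\<bar> \<le> 0" by (rule field_le_epsilon)
  then show ?thesis by simp
qed

theorem theorem1p12:
  fixes G :: "('a, 'b) monoid_scheme" and \<nu> :: "'a \<Rightarrow> real"
  assumes "group G"
    and "has_FM G"
    and "conj_inv_pseudo_norm G \<nu>"
  shows "(\<forall>g\<in>carrier G. stab G \<nu> g > 0 \<longrightarrow>
            (\<exists>\<phi>::'a \<Rightarrow> real. (\<forall>H\<in>FM_set G. hom_H_quasimorphism G H \<phi>) \<and> \<phi> g > 0))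
       \<and> (\<forall>g\<in>derived G (carrier G). \<forall>H\<in>FM_set G.
            ereal (stab G \<nu> g) \<le>
              8 * (SUP \<phi>\<in>{\<phi>::'a \<Rightarrow> real. hom_H_quasimorphism G H \<phi>}.
                     ereal (\<phi> g * fa_energy G H \<nu> H / qm_defect G H \<phi>)))"
proof (intro conjI ballI impI)
  interpret FM_normed_group G \<nu> using assms by (simp add: FM_normed_group_def FM_normed_group_axioms_def)
  have functional: "\<exists>q. additive_functional G \<nu> q \<and> q g = stab G \<nu> g" if "g \<in> carrier G" for g
    by (rule exists_additive_functional[OF that])
      (use FM_normed_group_axioms in \<open>auto simp: additive_functional_def additive_functional_axioms_def\<close>)
  have quasi: "hom_H_quasimorphism G H q" if "additive_functional G \<nu> q" "FM_pair G H" for H q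
  proof -
    interpret additive_functional G \<nu> q by (rule that(1))
    \<comment> \<open>The maximum with 1 keeps the constant positive even if the energy is
      0.\<close>
    have "qm_bound G H q (max 1 (4 * fa_energy G H \<nu> H))" by (rule functional_qm_bound[OF that(2)]) simp
    then have "\<exists>C>0. qm_bound G H q C" by (intro exI[of _ "max 1 (4 * fa_energy G H \<nu> H)"]) simp
    then show ?thesis using functional_homogeneous by (simp add: hom_H_quasimorphism_def H_quasimorphism_def)
  qed
  show "\<exists>\<phi>. (\<forall>H\<in>FM_set G. hom_H_quasimorphism G H \<phi>) \<and> 0 < \<phi> g"
    if "g \<in> carrier G" "0 < stab G \<nu> g" for g
    using functional[OF that(1)] that(2) quasi unfolding FM_set_def by force
  fix g H assume g: "g \<in> derived G (carrier G)" and "H \<in> FM_set G"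
  then have H: "FM_pair G H" by (simp add: FM_set_def)
  have gG: "g \<in> carrier G" using g derived_in_carrier by blast
  define E where "E = fa_energy G H \<nu> H"
  define S where "S = (SUP \<phi>\<in>{\<phi>. hom_H_quasimorphism G H \<phi>}. ereal (\<phi> g * E / qm_defect G H \<phi>))"
  have upper: "ereal (\<phi> g * E / qm_defect G H \<phi>) \<le> S" if "hom_H_quasimorphism G H \<phi>" for \<phi>
    unfolding S_def using that by (intro SUP_upper) simp
  have "ereal (stab G \<nu> g) \<le> 8 * S"
  proof (cases "stab G \<nu> g > 0")
    case False
    \<comment> \<open>The zero function contributes the value 0, so the supremum is
      nonnegative.\<close>
    have "qm_bound G H (\<lambda>_. 0) 1" by (simp add: qm_bound_def ereal_of_enat_nonneg flip: zero_ereal_def)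
    then have "hom_H_quasimorphism G H (\<lambda>_. 0)"
      unfolding hom_H_quasimorphism_def H_quasimorphism_def homogeneous_def
      by (intro conjI exI[of _ 1]) simp_all
    from upper[OF this] have "0 \<le> S" by (simp add: zero_ereal_def)
    then have "0 \<le> 8 * S" by simp
    moreover have "ereal (stab G \<nu> g) \<le> 0" using False by simp
    ultimately show ?thesis by (rule order_trans[rotated])
  next
    case True
    obtain q where q: "additive_functional G \<nu> q" "q g = stab G \<nu> g" using functional[OF gG] by blast
    interpret additive_functional G \<nu> q by (rule q(1))
    define A where "A = {C. C > 0 \<and> qm_bound G H q C}"
    define D where "D = qm_defect G H q"
    have D: "D = Inf A" by (simp add: D_def A_def qm_defect_def)
    have bdd: "bdd_below A" by (rule bdd_belowI[of _ 0]) (simp add: A_def)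
    have A: "C \<in> A" if "C > 0" "4 * E \<le> C" for C
      using functional_qm_bound[OF H] that by (simp add: A_def E_def)
    have "max 1 (4 * E) \<in> A" by (rule A) simp_all
    then have ne: "A \<noteq> {}" by blast
    \<comment> \<open>With defect 0 the quotient would be 0 by convention. This is excluded:
      \<open>q\<close> would be a homomorphism and vanish at \<open>g\<close>, which lies in the
      derived subgroup, although \<open>q g\<close> is the positive stabilization.\<close>
    have D_pos: "D > 0"
    proof (rule ccontr)
      assume "\<not> D > 0"
      have "\<exists>C<e. qm_bound G H q C" if "e > 0" for e
        using cInf_less_iff[OF ne bdd, of e] that \<open>\<not> D > 0\<close> by (auto simp: D A_def)
      then have "q (x \<otimes>\<^bsub>G\<^esub> y) = q x + q y" if "x \<in> carrier G" "y \<in> carrier G" for x y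
        using hom_if_small_defect[of H x y q] that H unfolding FM_pair_def by blast
      then have "q g = 0" by (rule vanishes_on_derived[OF _ g])
      then show False using True q(2) by simp
    qed
    \<comment> \<open>Members of \<open>A\<close> are positive, so \<open>4 * E\<close> is
      approached from above by admissible constants.\<close>
    have "D \<le> max 0 (4 * E) + e" if "e > 0" for e
      unfolding D by (rule cInf_lower[OF A bdd]) (use that in auto)
    then have "D \<le> max 0 (4 * E)" by (rule field_le_epsilon)
    then have DE: "D \<le> 4 * E" using D_pos by simp
    \<comment> \<open>As \<open>q g\<close> is the stabilization, this amounts to
      \<open>D \<le> 8 * E\<close>, which follows from \<open>D \<le> 4 * E\<close> and
      \<open>D > 0\<close>.\<close>
    have "stab G \<nu> g \<le> 8 * (q g * E / D)"
    proof -
      have "q g * D \<le> q g * (8 * E)" using True q(2) DE D_pos by (intro mult_left_mono) simp_all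
      then show ?thesis using D_pos q(2) by (simp add: field_simps)
    qed
    then have "ereal (stab G \<nu> g) \<le> 8 * ereal (q g * E / D)" by simp
    also have "\<dots> \<le> 8 * S"
      using upper[OF quasi[OF q(1) H]] by (intro ereal_mult_left_mono) (simp_all add: D_def)
    finally show ?thesis .
  qed
  then show "ereal (stab G \<nu> g) \<le> 8 * (SUP \<phi>\<in>{\<phi>. hom_H_quasimorphism G H \<phi>}.
      ereal (\<phi> g * fa_energy G H \<nu> H / qm_defect G H \<phi>))"
    by (simp add: S_def E_def)
qed

end
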